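(* Let $0<q<\frac12$ and let $n\ge 1$ be an integer. Consider the two-phase game with parameters $(q,n)$ described in the context, and let $E_n(q)$ be the conditional expectation of the duration of Phase II given that team B wins. Let $$A_n(q)=\frac{q^n}{1-2q}\sum_{m=0}^{n-1}\binom{n+m-1}{m}(1-q)^m\,(n-m),$$ $$R_n(q)=1-(1-q)^n\sum_{m=0}^{n-1}\binom{n+m-1}{m}q^m+q^n\sum_{m=0}^{n-1}\binom{n+m-1}{m}(1-q)^m .$$ Then $$E_n(q)=\frac{A_n(q)}{R_n(q)}.$$
   Context: The two-phase game with parameters $q\in(0,\frac12)$ and positive integer $n$: two teams, G and B, play; each successive goal is scored by B with probability $q$ and by G with probability $1-q$, independently of all other goals. Phase I: play until G has scored $n$ goals; let $m$ be the number of goals B has scored by then. Phase II: if $m\ge n$, team B is declared the winner immediately (Phase II has duration $0$). If $m<n$, they keep playing until B has caught up and tied the score, in which case B is declared the winner; if B never ties the score, B loses. The duration of Phase II is the number of goals scored (by either team) during Phase II. $R_n(q)$ is the probability that B wins. *)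

theory Defs
  imports "HOL-Probability.Probability"
begin

text \<open>
  A play is an infinite stream of goals, the entry \<open>True\<close> standing for a goal of team B and
  \<open>False\<close> for a goal of team G.  The goals continue forever in the model; the game only looks
  at the part of the stream it needs.
\<close>

definition goal_space :: "real \<Rightarrow> bool stream measure" where
  "goal_space q = stream_space (measure_pmf (bernoulli_pmf q))"

definition goals_B :: "bool stream \<Rightarrow> nat \<Rightarrow> nat" where
  "goals_B \<omega> t = card {i \<in> {..<t}. \<omega> !! i}"

definition goals_G :: "bool stream \<Rightarrow> nat \<Rightarrow> nat" where
  "goals_G \<omega> t = card {i \<in> {..<t}. \<not> \<omega> !! i}"

definition phase1_terminates :: "nat \<Rightarrow> bool stream \<Rightarrow> bool" where
  "phase1_terminates n \<omega> \<longleftrightarrow> (\<exists>t. goals_G \<omega> t = n)"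

text \<open>Unspecified on the null event that Phase I does not terminate.\<close>

definition phase1_length :: "nat \<Rightarrow> bool stream \<Rightarrow> nat" where
  "phase1_length n \<omega> = (LEAST t. goals_G \<omega> t = n)"

definition phase1_goals_B :: "nat \<Rightarrow> bool stream \<Rightarrow> nat" where
  "phase1_goals_B n \<omega> = goals_B \<omega> (phase1_length n \<omega>)"

definition tied_in_phase2 :: "nat \<Rightarrow> bool stream \<Rightarrow> nat \<Rightarrow> bool" where
  "tied_in_phase2 n \<omega> d \<longleftrightarrow>
     goals_B \<omega> (phase1_length n \<omega> + d) = goals_G \<omega> (phase1_length n \<omega> + d)"

definition B_wins :: "nat \<Rightarrow> bool stream \<Rightarrow> bool" where
  "B_wins n \<omega> \<longleftrightarrow>
     phase1_terminates n \<omega> \<and> (phase1_goals_B n \<omega> \<ge> n \<or> (\<exists>d. tied_in_phase2 n \<omega> d))"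

text \<open>The infimum of the empty set is \<open>\<infinity>\<close>: if B trails and never ties, Phase II never ends.\<close>

definition phase2_duration :: "nat \<Rightarrow> bool stream \<Rightarrow> enat" where
  "phase2_duration n \<omega> =
     (if phase1_goals_B n \<omega> \<ge> n then 0 else (INF d \<in> {d. tied_in_phase2 n \<omega> d}. enat d))"

text \<open>
  The expectation is taken in \<open>[0, \<infinity>]\<close>, so that its finiteness is part of any claim that it
  equals a real number.
\<close>

definition expected_duration :: "nat \<Rightarrow> real \<Rightarrow> ennreal" where
  "expected_duration n q =
     (\<integral>\<^sup>+ \<omega>. ennreal_of_enat (phase2_duration n \<omega>)
        \<partial>uniform_measure (goal_space q) {\<omega> \<in> space (goal_space q). B_wins n \<omega>})"

definition A_n :: "nat \<Rightarrow> real \<Rightarrow> real" where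
  "A_n n q = q ^ n / (1 - 2 * q) *
     (\<Sum>m = 0..n - 1. real ((n + m - 1) choose m) * (1 - q) ^ m * (real n - real m))"

definition R_n :: "nat \<Rightarrow> real \<Rightarrow> real" where
  "R_n n q = 1 - (1 - q) ^ n * (\<Sum>m = 0..n - 1. real ((n + m - 1) choose m) * q ^ m)
             + q ^ n * (\<Sum>m = 0..n - 1. real ((n + m - 1) choose m) * (1 - q) ^ m)"

end

theory Submission
  imports Defs
begin

text \<open>
  At the end of Phase I, team B has scored exactly \<open>m\<close> goals with the negative binomial
  probability \<open>((n + m - 1) choose m) * (1 - q) ^ n * q ^ m\<close>.  By the strong Markov property,
  Phase II with \<open>m < n\<close> is the time a fresh random walk needs to climb from \<open>0\<close> to
  \<open>k = n - m\<close>.  With \<open>r = q / (1 - q)\<close>, this time is finite with probability \<open>r ^ k\<close> and has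
  expectation \<open>k * r ^ k / (1 - 2 * q)\<close> on that event.  Both follow from first-step analysis: the
  truncated quantities are bounded by these values by induction on the time horizon, hence the
  true ones tend to \<open>0\<close> as \<open>k\<close> grows, and the first-step recurrence has only one such solution.
\<close>

section \<open>Counting goals along a stream\<close>

lemma goals_B_eq_sum: "goals_B \<omega> t = (\<Sum>i<t. of_bool (\<omega> !! i))"
  by (simp add: goals_B_def sum.If_cases of_bool_def Int_def)

lemma goals_G_eq_sum: "goals_G \<omega> t = (\<Sum>i<t. of_bool (\<not> \<omega> !! i))"
  by (simp add: goals_G_def sum.If_cases of_bool_def Int_def)

lemma goals_0 [simp]: "goals_B \<omega> 0 = 0" "goals_G \<omega> 0 = 0"
  by (simp_all add: goals_B_def goals_G_def)

lemma goals_Stream_Suc [simp]: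
  "goals_B (x ## \<omega>) (Suc t) = of_bool x + goals_B \<omega> t"
  "goals_G (x ## \<omega>) (Suc t) = of_bool (\<not> x) + goals_G \<omega> t"
  by (simp_all add: goals_B_eq_sum goals_G_eq_sum sum.lessThan_Suc_shift del: sum.lessThan_Suc)

lemma goals_Suc:
  "goals_B \<omega> (Suc t) = goals_B \<omega> t + of_bool (\<omega> !! t)"
  "goals_G \<omega> (Suc t) = goals_G \<omega> t + of_bool (\<not> \<omega> !! t)"
  by (simp_all add: goals_B_eq_sum goals_G_eq_sum)

lemma goals_B_plus_goals_G: "goals_B \<omega> t + goals_G \<omega> t = t"
  by (induction t) (auto simp: goals_Suc)

lemma goals_add:
  "goals_B \<omega> (s + t) = goals_B \<omega> s + goals_B (sdrop s \<omega>) t"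
  "goals_G \<omega> (s + t) = goals_G \<omega> s + goals_G (sdrop s \<omega>) t"
  by (induction t) (auto simp: goals_Suc sdrop_snth add.commute)

section \<open>The end of Phase I and first-passage times of the score difference\<close>

text \<open>Phase I ending with \<open>m\<close> goals of B must last exactly \<open>n + m\<close>
  goals. Fixing that time replaces \<open>LEAST\<close> by a condition on finitely many goals, which
  suits both measurability and recursion on the first goal.\<close>

definition phase1_ends :: "nat \<Rightarrow> nat \<Rightarrow> bool stream \<Rightarrow> bool" where
  "phase1_ends n m \<omega> \<longleftrightarrow> goals_G \<omega> (n + m) = n \<and> (\<forall>s<n + m. goals_G \<omega> s \<noteq> n)"

text \<open>This is the event that the walk "goals of B minus goals of G" first hits level
  \<open>k\<close> at time \<open>t\<close>, written additively to avoid truncated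
  subtraction.\<close>

definition first_lead :: "nat \<Rightarrow> nat \<Rightarrow> bool stream \<Rightarrow> bool" where
  "first_lead k t \<omega> \<longleftrightarrow>
     goals_B \<omega> t = k + goals_G \<omega> t \<and> (\<forall>s<t. goals_B \<omega> s \<noteq> k + goals_G \<omega> s)"

lemma phase1_ends_0 [simp]: "phase1_ends 0 m \<omega> \<longleftrightarrow> m = 0"
  by (auto simp: phase1_ends_def)

text \<open>First-step rules: a goal of G uses up one of the \<open>n\<close> awaited goals, a goal
  of B one of the \<open>m\<close>. In the middle case only \<open>n\<close> goals remain after B's,
  too few for \<open>Suc n\<close> goals of G by time \<open>Suc n\<close>.\<close>

lemma phase1_ends_Stream [simp]:
  "phase1_ends (Suc n) m (False ## \<omega>) \<longleftrightarrow> phase1_ends n m \<omega>"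
  "\<not> phase1_ends (Suc n) 0 (True ## \<omega>)"
  "phase1_ends (Suc n) (Suc m) (True ## \<omega>) \<longleftrightarrow> phase1_ends (Suc n) m \<omega>"
proof -
  have "goals_G \<omega> n \<le> n"
    using goals_B_plus_goals_G[of \<omega> n] by linarith
  then show "\<not> phase1_ends (Suc n) 0 (True ## \<omega>)"
    by (simp add: phase1_ends_def)
qed (simp_all add: phase1_ends_def All_less_Suc2)

lemma first_lead_0 [simp]: "first_lead 0 t \<omega> \<longleftrightarrow> t = 0"
  by (auto simp: first_lead_def)

lemma first_lead_Suc_0 [simp]: "\<not> first_lead (Suc k) 0 \<omega>"
  by (simp add: first_lead_def)

lemma first_lead_Stream [simp]:
  "first_lead (Suc k) (Suc t) (True ## \<omega>) \<longleftrightarrow> first_lead k t \<omega>"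
  "first_lead (Suc k) (Suc t) (False ## \<omega>) \<longleftrightarrow> first_lead (Suc (Suc k)) t \<omega>"
  by (simp_all add: first_lead_def All_less_Suc2)

lemma phase1_length_eq:
  assumes "phase1_ends n m \<omega>"
  shows "phase1_length n \<omega> = n + m"
  unfolding phase1_length_def
proof (rule Least_equality)
  show "n + m \<le> t" if "goals_G \<omega> t = n" for t
    using assms that by (auto simp: phase1_ends_def not_less[symmetric])
qed (use assms in \<open>simp add: phase1_ends_def\<close>)

text \<open>The link back to the \<open>LEAST\<close>-based definitions: both teams' goals add up to
  the elapsed time, so \<open>n\<close> goals of G and \<open>m\<close> of B determine the time
  \<open>n + m\<close>, and conversely.\<close>

lemma phase1_ends_iff:
  "phase1_ends n m \<omega> \<longleftrightarrow> phase1_terminates n \<omega> \<and> phase1_goals_B n \<omega> = m"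
proof
  assume ends: "phase1_ends n m \<omega>"
  then have "goals_G \<omega> (n + m) = n"
    by (simp add: phase1_ends_def)
  then show "phase1_terminates n \<omega> \<and> phase1_goals_B n \<omega> = m"
    using goals_B_plus_goals_G[of \<omega> "n + m"] phase1_length_eq[OF ends]
    by (auto simp: phase1_terminates_def phase1_goals_B_def)
next
  assume *: "phase1_terminates n \<omega> \<and> phase1_goals_B n \<omega> = m"
  then obtain t where "goals_G \<omega> t = n"
    unfolding phase1_terminates_def by blast
  then have "goals_G \<omega> (phase1_length n \<omega>) = n"
    unfolding phase1_length_def by (rule LeastI)
  moreover from this have "phase1_length n \<omega> = n + m"
    using * goals_B_plus_goals_G[of \<omega> "phase1_length n \<omega>"] by (simp add: phase1_goals_B_def)
  moreover have "goals_G \<omega> s \<noteq> n" if "s < phase1_length n \<omega>" for s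
    using not_less_Least[OF that[unfolded phase1_length_def]] .
  ultimately show "phase1_ends n m \<omega>"
    by (simp add: phase1_ends_def)
qed

lemma tied_in_phase2_iff:
  assumes "phase1_ends n m \<omega>" "m \<le> n"
  shows "tied_in_phase2 n \<omega> d \<longleftrightarrow>
    goals_B (sdrop (n + m) \<omega>) d = (n - m) + goals_G (sdrop (n + m) \<omega>) d"
proof -
  have "goals_G \<omega> (n + m) = n" "goals_B \<omega> (n + m) = m"
    using assms goals_B_plus_goals_G[of \<omega> "n + m"] by (auto simp: phase1_ends_def)
  then show ?thesis
    using assms(2) by (auto simp: tied_in_phase2_def phase1_length_eq[OF assms(1)] goals_add)
qed

section \<open>B's win and the duration of Phase II in terms of elementary events\<close>

text \<open>Splitting the stream at \<open>n + m\<close> separates Phase I from Phase II. For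
  \<open>m < n\<close>, \<open>t\<close> is the duration of Phase II, counted from the
  split.\<close>

definition catches_up :: "nat \<Rightarrow> nat \<Rightarrow> nat \<Rightarrow> bool stream \<Rightarrow> bool" where
  "catches_up n m t \<omega> \<longleftrightarrow> phase1_ends n m \<omega> \<and> first_lead (n - m) t (sdrop (n + m) \<omega>)"

lemma first_lead_exists_iff:
  "(\<exists>t. first_lead k t \<omega>) \<longleftrightarrow> (\<exists>t. goals_B \<omega> t = k + goals_G \<omega> t)"
  unfolding first_lead_def using exists_least_iff[of "\<lambda>t. goals_B \<omega> t = k + goals_G \<omega> t"] by auto

lemma first_lead_unique: "first_lead k s \<omega> \<Longrightarrow> first_lead k t \<omega> \<Longrightarrow> s = t"
  unfolding first_lead_def by (metis linorder_neqE_nat)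

lemma phase1_ends_unique: "phase1_ends n l \<omega> \<Longrightarrow> phase1_ends n m \<omega> \<Longrightarrow> l = m"
  by (simp add: phase1_ends_iff)

text \<open>The first disjunct is a win at the end of Phase I, the second a comeback. They exclude
  each other, and both are countable combinations of events with computable probability.\<close>

lemma B_wins_iff:
  "B_wins n \<omega> \<longleftrightarrow>
     (phase1_terminates n \<omega> \<and> (\<forall>m<n. \<not> phase1_ends n m \<omega>)) \<or> (\<exists>m<n. \<exists>t. catches_up n m t \<omega>)"
proof (cases "\<exists>m<n. phase1_ends n m \<omega>")
  case True
  then obtain m where m: "m < n" "phase1_ends n m \<omega>"
    by blast
  then have "B_wins n \<omega> \<longleftrightarrow> (\<exists>t. first_lead (n - m) t (sdrop (n + m) \<omega>))"
    using tied_in_phase2_iff[OF m(2)] unfolding first_lead_exists_iff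
    by (simp add: B_wins_def phase1_ends_iff)
  also have "\<dots> \<longleftrightarrow> (\<exists>m<n. \<exists>t. catches_up n m t \<omega>)"
  proof -
    have "catches_up n l t \<omega> \<longleftrightarrow> l = m \<and> first_lead (n - m) t (sdrop (n + m) \<omega>)" for l t
      unfolding catches_up_def using m(2) phase1_ends_unique[OF m(2), of l] by blast
    then show ?thesis
      using m(1) by simp
  qed
  finally have iff: "B_wins n \<omega> \<longleftrightarrow> (\<exists>m<n. \<exists>t. catches_up n m t \<omega>)" .
  show ?thesis
    unfolding iff using True by blast
next
  case False
  then have "phase1_terminates n \<omega> \<Longrightarrow> n \<le> phase1_goals_B n \<omega>"
    using phase1_ends_iff[of n "phase1_goals_B n \<omega>" \<omega>] by (meson not_less)
  then have "B_wins n \<omega> \<longleftrightarrow> phase1_terminates n \<omega>"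
    unfolding B_wins_def by blast
  then show ?thesis
    using False by (auto simp: catches_up_def)
qed

lemma phase2_duration_catches_up:
  assumes "catches_up n m t \<omega>" "m < n"
  shows "phase2_duration n \<omega> = enat t"
proof -
  let ?S = "{d. tied_in_phase2 n \<omega> d}"
  have ends: "phase1_ends n m \<omega>" and lead: "first_lead (n - m) t (sdrop (n + m) \<omega>)"
    using assms by (auto simp: catches_up_def)
  have "t \<in> ?S" "\<And>d. d \<in> ?S \<Longrightarrow> t \<le> d"
    using lead tied_in_phase2_iff[OF ends] assms(2)
    unfolding first_lead_def by (auto simp: not_less[symmetric])
  then have "(INF d\<in>?S. enat d) = enat t"
    by (intro antisym INF_lower INF_greatest) auto
  then show ?thesis
    using ends assms(2) by (simp add: phase2_duration_def phase1_ends_iff)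
qed

text \<open>At most one pair \<open>(m, t)\<close> with \<open>m < n\<close> contributes, since the
  end of Phase I and the first tie are unique. A win without comeback has duration 0, matching the
  empty contribution. As a countable sum of indicators the duration can be integrated
  termwise.\<close>

lemma phase2_duration_eq_sum:
  assumes "B_wins n \<omega>"
  shows "ennreal_of_enat (phase2_duration n \<omega>) =
    (\<Sum>t. \<Sum>m<n. of_nat t * indicator {\<omega>. catches_up n m t \<omega>} \<omega>)"
proof (cases "\<exists>m<n. \<exists>t. catches_up n m t \<omega>")
  case True
  then obtain m t where mt: "m < n" "catches_up n m t \<omega>"
    by blast
  then have iff: "catches_up n l s \<omega> \<longleftrightarrow> l = m \<and> s = t" for l s
    by (auto simp: catches_up_def dest: phase1_ends_unique first_lead_unique)
  have "(\<Sum>l<n. of_nat s * indicator {\<omega>. catches_up n l s \<omega>} \<omega>) =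
      (if s = t then of_nat t else (0::ennreal))" for s
    using mt(1) by (simp add: iff indicator_def if_distrib sum.delta cong: if_cong)
  then have "(\<Sum>t. \<Sum>m<n. of_nat t * indicator {\<omega>. catches_up n m t \<omega>} \<omega>) = (of_nat t :: ennreal)"
    using sums_unique[OF sums_single[of t "\<lambda>_. of_nat t :: ennreal"]] by simp
  then show ?thesis
    using phase2_duration_catches_up[OF mt(2,1)] by simp
next
  case False
  then have "phase2_duration n \<omega> = 0"
    using assms False by (auto simp: B_wins_iff phase2_duration_def phase1_ends_iff not_less)
  moreover have "(\<Sum>t. \<Sum>m<n. of_nat t * indicator {\<omega>. catches_up n m t \<omega>} \<omega>) = (0 :: ennreal)"
    using False by (simp add: indicator_def)
  ultimately show ?thesis
    by simp
qed

section \<open>Measurability of the game's events\<close>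

lemma space_goal_space [simp]: "space (goal_space q) = UNIV"
  by (simp add: goal_space_def space_stream_space)

lemma prob_space_goal_space: "prob_space (goal_space q)"
  unfolding goal_space_def by (rule prob_space.prob_space_stream_space[OF prob_space_measure_pmf])

lemma snth_measurable_goal_space [measurable]:
  "(\<lambda>\<omega>. \<omega> !! i) \<in> measurable (goal_space q) (count_space UNIV)"
proof -
  have "(\<lambda>\<omega>. \<omega> !! i) \<in> measurable (goal_space q) (measure_pmf (bernoulli_pmf q))"
    unfolding goal_space_def by measurable
  then show ?thesis
    by (simp cong: measurable_cong_sets)
qed

lemma sdrop_measurable_goal_space [measurable]:
  "sdrop i \<in> measurable (goal_space q) (goal_space q)"
  unfolding goal_space_def by measurable

lemma goals_measurable [measurable]:
  "(\<lambda>\<omega>. goals_B \<omega> t) \<in> measurable (goal_space q) (count_space UNIV)"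
  "(\<lambda>\<omega>. goals_G \<omega> t) \<in> measurable (goal_space q) (count_space UNIV)"
  unfolding goals_B_eq_sum goals_G_eq_sum of_bool_def by measurable

lemma phase1_ends_measurable [measurable]: "Measurable.pred (goal_space q) (phase1_ends n m)"
  unfolding phase1_ends_def by measurable

lemma phase1_terminates_measurable [measurable]:
  "Measurable.pred (goal_space q) (phase1_terminates n)"
  unfolding phase1_terminates_def by measurable

lemma first_lead_measurable [measurable]: "Measurable.pred (goal_space q) (first_lead k t)"
proof -
  \<comment> \<open>As the two counts add up to \<open>s\<close>, the condition involves the single
    count \<open>goals_B \<omega> s\<close> lying in a fixed set, whose measurability is
    immediate.\<close>
  have eq: "goals_B \<omega> s = k + goals_G \<omega> s \<longleftrightarrow> goals_B \<omega> s \<in> {b. 2 * b = k + s}" for \<omega> s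
    using goals_B_plus_goals_G[of \<omega> s] by auto
  show ?thesis
    unfolding first_lead_def eq by measurable
qed

lemma catches_up_measurable [measurable]: "Measurable.pred (goal_space q) (catches_up n m t)"
  unfolding catches_up_def by measurable

lemma B_wins_measurable [measurable]: "Measurable.pred (goal_space q) (B_wins n)"
  unfolding B_wins_iff by measurable

lemma sets_goal_space_Collect: "Measurable.pred (goal_space q) P \<Longrightarrow> {\<omega>. P \<omega>} \<in> sets (goal_space q)"
  by (simp add: pred_def)

section \<open>First-step analysis and the law of Phase I\<close>

text \<open>The stream measure is the law of an independent first goal followed by a fresh stream,
  so conditioning on that goal yields the two weighted terms.\<close>

lemma prob_first_goal:
  assumes "0 \<le> q" "q \<le> 1" and "Measurable.pred (goal_space q) P"
  shows "measure (goal_space q) {\<omega>. P \<omega>} =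
    q * measure (goal_space q) {\<omega>. P (True ## \<omega>)} +
    (1 - q) * measure (goal_space q) {\<omega>. P (False ## \<omega>)}"
proof -
  have "{\<omega> \<in> space (goal_space q). P \<omega>} \<in> sets (goal_space q)"
    using assms(3) by (simp add: pred_def)
  from prob_space.prob_stream_space[OF prob_space_measure_pmf this[unfolded goal_space_def]]
  have "ennreal (measure (goal_space q) {\<omega>. P \<omega>}) =
      ennreal (q * measure (goal_space q) {\<omega>. P (True ## \<omega>)} +
        (1 - q) * measure (goal_space q) {\<omega>. P (False ## \<omega>)})"
    using assms(1,2) by (simp flip: goal_space_def add: mult.commute ennreal_mult ennreal_plus)
  then show ?thesis
    using assms(1,2) by (subst (asm) ennreal_inj) auto
qed

text \<open>The strong Markov property in the form needed: the stream after Phase I is independent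
  of how Phase I ended and has the original law. Carrying \<open>P\<close> through the induction
  proves this together with the negative binomial law.\<close>

lemma prob_phase1_ends_shift:
  assumes q: "0 \<le> q" "q \<le> 1" and P[measurable]: "Measurable.pred (goal_space q) P"
  shows "measure (goal_space q) {\<omega>. phase1_ends n m \<omega> \<and> P (sdrop (n + m) \<omega>)} =
    real ((n + m - 1) choose m) * (1 - q) ^ n * q ^ m * measure (goal_space q) {\<omega>. P \<omega>}"
proof (induction "n + m" arbitrary: n m)
  case 0
  then show ?case by simp
next
  case (Suc k)
  show ?case
  proof (cases n)
    case 0
    \<comment> \<open>Here \<open>m > 0\<close>, so \<open>(m - 1) choose m\<close> is 0, in
      agreement with \<open>phase1_ends 0 m\<close> being false.\<close>
    then show ?thesis
      using Suc(2) by (cases m) auto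
  next
    case n: (Suc n')
    let ?p = "measure (goal_space q)"
    have split: "?p {\<omega>. phase1_ends n m \<omega> \<and> P (sdrop (n + m) \<omega>)} =
        q * ?p {\<omega>. phase1_ends n m (True ## \<omega>) \<and> P (sdrop (n + m) (True ## \<omega>))} +
        (1 - q) * ?p {\<omega>. phase1_ends n m (False ## \<omega>) \<and> P (sdrop (n + m) (False ## \<omega>))}"
      by (rule prob_first_goal[OF q]) measurable
    have False_branch: "?p {\<omega>. phase1_ends n' m \<omega> \<and> P (sdrop (n' + m) \<omega>)} =
        real ((n' + m - 1) choose m) * (1 - q) ^ n' * q ^ m * ?p {\<omega>. P \<omega>}"
      using Suc n by auto
    show ?thesis
    proof (cases m)
      case 0
      then show ?thesis
        using split False_branch n by simp
    next
      case m: (Suc m')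
      have True_branch: "?p {\<omega>. phase1_ends n m' \<omega> \<and> P (sdrop (n + m') \<omega>)} =
          real ((n + m' - 1) choose m') * (1 - q) ^ n * q ^ m' * ?p {\<omega>. P \<omega>}"
        using Suc m by auto
      have "?p {\<omega>. phase1_ends n m \<omega> \<and> P (sdrop (n + m) \<omega>)} =
          q * ?p {\<omega>. phase1_ends n m' \<omega> \<and> P (sdrop (n + m') \<omega>)} +
          (1 - q) * ?p {\<omega>. phase1_ends n' m \<omega> \<and> P (sdrop (n' + m) \<omega>)}"
        using split by (simp add: n m)
      \<comment> \<open>The weights of both branches agree, and the binomial coefficients add up by
        Pascal's rule.\<close>
      then show ?thesis
        unfolding True_branch False_branch by (simp add: n m algebra_simps)
    qed
  qed
qed

lemma prob_phase1_ends:
  assumes "0 \<le> q" "q \<le> 1"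
  shows "measure (goal_space q) {\<omega>. phase1_ends n m \<omega>} =
    real ((n + m - 1) choose m) * (1 - q) ^ n * q ^ m"
  using prob_phase1_ends_shift[OF assms, of "\<lambda>_. True"]
    prob_space.prob_space[OF prob_space_goal_space, of q] by simp

lemma phase1_terminates_Stream:
  "phase1_terminates 0 \<omega>"
  "phase1_terminates (Suc n) (True ## \<omega>) \<longleftrightarrow> phase1_terminates (Suc n) \<omega>"
  "phase1_terminates (Suc n) (False ## \<omega>) \<longleftrightarrow> phase1_terminates n \<omega>"
proof -
  have *: "(\<exists>t. P t) \<longleftrightarrow> P 0 \<or> (\<exists>t. P (Suc t))" for P :: "nat \<Rightarrow> bool"
    by (metis not0_implies_Suc)
  show "phase1_terminates 0 \<omega>"
    using goals_0(2) unfolding phase1_terminates_def by blast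
  show "phase1_terminates (Suc n) (True ## \<omega>) \<longleftrightarrow> phase1_terminates (Suc n) \<omega>"
    "phase1_terminates (Suc n) (False ## \<omega>) \<longleftrightarrow> phase1_terminates n \<omega>"
    unfolding phase1_terminates_def by (subst *, simp)+
qed

text \<open>By the induction hypothesis a first goal of G leads to certain termination, so the
  probability \<open>p\<close> satisfies \<open>p = q * p + (1 - q)\<close>, which forces
  \<open>p = 1\<close> because \<open>q < 1\<close>.\<close>

lemma prob_phase1_terminates:
  assumes "0 \<le> q" "q < 1"
  shows "measure (goal_space q) {\<omega>. phase1_terminates n \<omega>} = 1"
proof (induction n)
  case 0
  then show ?case
    using prob_space.prob_space[OF prob_space_goal_space, of q] by (simp add: phase1_terminates_Stream)
next
  case (Suc n)
  have "measure (goal_space q) {\<omega>. phase1_terminates (Suc n) \<omega>} =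
      q * measure (goal_space q) {\<omega>. phase1_terminates (Suc n) \<omega>} + (1 - q)"
    using prob_first_goal[of q "phase1_terminates (Suc n)"] assms Suc
    by (simp add: phase1_terminates_Stream)
  then have "(1 - q) * (measure (goal_space q) {\<omega>. phase1_terminates (Suc n) \<omega>} - 1) = 0"
    by (simp add: algebra_simps)
  then show ?case
    using assms by simp
qed

section \<open>The first-passage law and uniqueness for the ruin recurrence\<close>

text \<open>The first-passage distribution by first-step recursion: a goal of B lowers the missing
  lead by one, a goal of G raises it by one. The time decreases in every call although the level may
  grow.\<close>

fun lead_prob :: "real \<Rightarrow> nat \<Rightarrow> nat \<Rightarrow> real" where
  "lead_prob q 0 t = of_bool (t = 0)"
| "lead_prob q (Suc k) 0 = 0"
| "lead_prob q (Suc k) (Suc t) = q * lead_prob q k t + (1 - q) * lead_prob q (Suc (Suc k)) t"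

lemma prob_first_lead:
  assumes "0 \<le> q" "q \<le> 1"
  shows "measure (goal_space q) {\<omega>. first_lead k t \<omega>} = lead_prob q k t"
proof (induction t arbitrary: k)
  case 0
  then show ?case
    using prob_space.prob_space[OF prob_space_goal_space, of q] by (cases k) simp_all
next
  case (Suc t)
  show ?case
  proof (cases k)
    case k: (Suc k')
    show ?thesis
      using prob_first_goal[OF assms, of "first_lead k (Suc t)"] Suc by (simp add: k)
  qed simp
qed

lemma prob_catches_up:
  assumes "0 \<le> q" "q \<le> 1"
  shows "measure (goal_space q) {\<omega>. catches_up n m t \<omega>} =
    real ((n + m - 1) choose m) * (1 - q) ^ n * q ^ m * lead_prob q (n - m) t"
  unfolding catches_up_def
  by (subst prob_phase1_ends_shift) (use assms in \<open>simp_all add: prob_first_lead\<close>)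

lemma lead_prob_nonneg: "0 \<le> q \<Longrightarrow> q \<le> 1 \<Longrightarrow> 0 \<le> lead_prob q k t"
  by (induction q k t rule: lead_prob.induct) auto

text \<open>The increments of \<open>d\<close> are geometric with ratio
  \<open>r = q / (1 - q) < 1\<close>, so \<open>d k\<close> is a multiple of
  \<open>1 - r ^ k\<close>. Such a sequence tends to 0 only if the multiple is 0.\<close>

lemma ruin_recurrence_unique:
  fixes d :: "nat \<Rightarrow> real"
  assumes q: "0 < q" "q < 1 / 2"
    and rec: "\<And>k. d (Suc k) = q * d k + (1 - q) * d (Suc (Suc k))"
    and "d 0 = 0" and lim: "d \<longlonglongrightarrow> 0"
  shows "d k = 0"
proof -
  define r where "r = q / (1 - q)"
  have r: "0 < r" "r < 1" and r_eq: "(1 - q) * r = q"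
    using q by (auto simp: r_def field_simps)
  have "d (Suc (Suc k)) - d (Suc k) = r * (d (Suc k) - d k)" for k
    using rec[of k] q by (simp add: r_def field_simps)
  then have diff: "d (Suc k) - d k = r ^ k * d 1" for k
    using \<open>d 0 = 0\<close> by (induction k) auto
  have closed: "(1 - r) * d k = d 1 * (1 - r ^ k)" for k
  proof (induction k)
    case (Suc k)
    then show ?case
      using diff[of k] by (simp add: algebra_simps) (metis distrib_left mult.commute mult.left_commute)
  qed (simp add: \<open>d 0 = 0\<close>)
  have "(\<lambda>k. (1 - r) * d k) \<longlonglongrightarrow> (1 - r) * 0"
    by (intro tendsto_intros lim)
  moreover have "(\<lambda>k. d 1 * (1 - r ^ k)) \<longlonglongrightarrow> d 1 * (1 - 0)"
    using r by (intro tendsto_intros LIMSEQ_power_zero) auto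
  ultimately have "d 1 = 0"
    using LIMSEQ_unique unfolding closed by fastforce
  then show ?thesis
    using closed[of k] r by simp
qed

section \<open>Total mass and expected time of the first passage\<close>

context
  fixes q r :: real
  assumes q: "0 < q" "q < 1 / 2"
  defines "r \<equiv> q / (1 - q)"
begin

lemma ratio_props: "0 < r" "r < 1" "(1 - q) * r = q"
  using q by (auto simp: r_def field_simps)

lemma ratio_power_shift:
  "q * r ^ k = (1 - q) * r ^ Suc k" "(1 - q) * r ^ Suc (Suc k) = q * r ^ Suc k"
  using ratio_props(3) by (metis mult.assoc power_Suc)+

text \<open>The candidate \<open>r ^ k\<close> solves the homogeneous first-step recurrence.\<close>

lemma ratio_power: "q * r ^ k + (1 - q) * r ^ Suc (Suc k) = r ^ Suc k"
  unfolding ratio_power_shift(1)[of k] ratio_power_shift(2)[of k] by (simp only: distrib_right[symmetric]) simp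

text \<open>The candidate for the expected time solves the recurrence with forcing term
  \<open>r ^ Suc k\<close>: the first goal adds one time unit on every path that eventually reaches
  the level.\<close>

lemma time_ratio_power:
  "q * (real k * r ^ k / (1 - 2 * q)) + (1 - q) * (real (Suc (Suc k)) * r ^ Suc (Suc k) / (1 - 2 * q)) +
     r ^ Suc k = real (Suc k) * r ^ Suc k / (1 - 2 * q)"
proof -
  have "q * (real k * r ^ k / (1 - 2 * q)) + (1 - q) * (real (Suc (Suc k)) * r ^ Suc (Suc k) / (1 - 2 * q)) =
      (real k * (q * r ^ k) + real (Suc (Suc k)) * ((1 - q) * r ^ Suc (Suc k))) / (1 - 2 * q)"
    by (simp add: add_divide_distrib mult_ac)
  \<comment> \<open>Both powers are turned into \<open>r ^ Suc k\<close>, leaving the coefficient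
    \<open>k * (1 - q) + (k + 2) * q = k + 2 * q\<close>.\<close>
  also have "\<dots> = (real k + 2 * q) * r ^ Suc k / (1 - 2 * q)"
    unfolding ratio_power_shift(1)[of k] ratio_power_shift(2)[of k] by (simp add: algebra_simps)
  finally show ?thesis
    using q by (simp add: field_simps)
qed

text \<open>The general weight \<open>w\<close> serves both the mass (\<open>w = 1\<close>) and the
  expected time (\<open>w t = t\<close>). The term at time 0 vanishes because the level is
  positive.\<close>

lemma sum_lead_prob_Suc:
  "(\<Sum>t<Suc N. w t * lead_prob q (Suc k) t) =
     q * (\<Sum>t<N. w (Suc t) * lead_prob q k t) +
     (1 - q) * (\<Sum>t<N. w (Suc t) * lead_prob q (Suc (Suc k)) t)"
  by (simp add: sum.lessThan_Suc_shift sum_distrib_left distrib_left mult_ac sum.distrib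
      del: sum.lessThan_Suc)

text \<open>Induction on the horizon for all levels at once: one step of the recurrence preserves
  the bound because \<open>r ^ k\<close> is a fixed point of it.\<close>

lemma sum_lead_prob_le: "(\<Sum>t<N. lead_prob q k t) \<le> r ^ k"
proof (induction N arbitrary: k)
  case 0
  then show ?case using ratio_props by simp
next
  case (Suc N)
  show ?case
  proof (cases k)
    case 0
    then show ?thesis
      by (simp add: sum.lessThan_Suc_shift del: sum.lessThan_Suc)
  next
    case k: (Suc j)
    have "(\<Sum>t<Suc N. lead_prob q k t) =
        q * (\<Sum>t<N. lead_prob q j t) + (1 - q) * (\<Sum>t<N. lead_prob q (Suc (Suc j)) t)"
      using sum_lead_prob_Suc[of "\<lambda>_. 1"] by (simp add: k del: sum.lessThan_Suc)
    also have "\<dots> \<le> q * r ^ j + (1 - q) * r ^ Suc (Suc j)"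
      using q by (intro add_mono mult_left_mono Suc) auto
    finally show ?thesis
      by (simp only: ratio_power k)
  qed
qed

lemma sum_time_lead_prob_le: "(\<Sum>t<N. real t * lead_prob q k t) \<le> real k * r ^ k / (1 - 2 * q)"
proof (induction N arbitrary: k)
  case 0
  then show ?case using ratio_props q by simp
next
  case (Suc N)
  show ?case
  proof (cases k)
    case 0
    then show ?thesis
      by (simp add: sum.lessThan_Suc_shift del: sum.lessThan_Suc)
  next
    case k: (Suc j)
    \<comment> \<open>The shifted weight is \<open>real (Suc t) = real t + 1\<close>; the last
      bracket collects the contributions of the 1.\<close>
    have "(\<Sum>t<Suc N. real t * lead_prob q k t) =
        q * (\<Sum>t<N. real t * lead_prob q j t) +
        (1 - q) * (\<Sum>t<N. real t * lead_prob q (Suc (Suc j)) t) +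
        (q * (\<Sum>t<N. lead_prob q j t) + (1 - q) * (\<Sum>t<N. lead_prob q (Suc (Suc j)) t))"
      unfolding k sum_lead_prob_Suc
      by (simp only: of_nat_Suc distrib_right distrib_left sum.distrib mult_1_left add_ac)
    also have "\<dots> \<le> q * (real j * r ^ j / (1 - 2 * q)) +
        (1 - q) * (real (Suc (Suc j)) * r ^ Suc (Suc j) / (1 - 2 * q)) +
        (q * r ^ j + (1 - q) * r ^ Suc (Suc j))"
      using q by (intro add_mono mult_left_mono Suc sum_lead_prob_le) auto
    also have "\<dots> = real k * r ^ k / (1 - 2 * q)"
      unfolding ratio_power time_ratio_power k ..
    finally show ?thesis .
  qed
qed

lemma lead_prob_summable: "summable (lead_prob q k)"
  using sum_lead_prob_le q by (intro summableI_nonneg_bounded) (auto simp: lead_prob_nonneg)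

lemma time_lead_prob_summable: "summable (\<lambda>t. real t * lead_prob q k t)"
  using sum_time_lead_prob_le q by (intro summableI_nonneg_bounded) (auto simp: lead_prob_nonneg)

lemma suminf_lead_prob_Suc:
  "(\<Sum>t. lead_prob q (Suc k) t) =
     q * (\<Sum>t. lead_prob q k t) + (1 - q) * (\<Sum>t. lead_prob q (Suc (Suc k)) t)"
  using suminf_split_head[OF lead_prob_summable[of "Suc k"]]
  by (simp add: suminf_add[symmetric] suminf_mult lead_prob_summable summable_mult)

lemma suminf_time_lead_prob_Suc:
  "(\<Sum>t. real t * lead_prob q (Suc k) t) =
     q * (\<Sum>t. real t * lead_prob q k t) + (1 - q) * (\<Sum>t. real t * lead_prob q (Suc (Suc k)) t) +
     (\<Sum>t. lead_prob q (Suc k) t)"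
proof -
  let ?e = "\<lambda>k t. real t * lead_prob q k t"
  have "summable (\<lambda>t. lead_prob q (Suc k) (Suc t))"
    unfolding summable_Suc_iff by (rule lead_prob_summable)
  then have "(\<lambda>t. q * ?e k t + (1 - q) * ?e (Suc (Suc k)) t + lead_prob q (Suc k) (Suc t)) sums
      (q * suminf (?e k) + (1 - q) * suminf (?e (Suc (Suc k))) + (\<Sum>t. lead_prob q (Suc k) (Suc t)))"
    by (intro sums_add sums_mult summable_sums time_lead_prob_summable)
  moreover have "?e (Suc k) (Suc t) =
      q * ?e k t + (1 - q) * ?e (Suc (Suc k)) t + lead_prob q (Suc k) (Suc t)" for t
    by (simp add: algebra_simps)
  ultimately have "(\<Sum>t. ?e (Suc k) (Suc t)) =
      q * suminf (?e k) + (1 - q) * suminf (?e (Suc (Suc k))) + (\<Sum>t. lead_prob q (Suc k) (Suc t))"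
    by (simp only: sums_unique[symmetric])
  then show ?thesis
    using suminf_split_head[OF time_lead_prob_summable[of "Suc k"]]
      suminf_split_head[OF lead_prob_summable[of "Suc k"]] by simp
qed

lemma ratio_power_tendsto: "(\<lambda>k. r ^ k) \<longlonglongrightarrow> 0" "(\<lambda>k. real k * r ^ k / (1 - 2 * q)) \<longlonglongrightarrow> 0"
proof -
  show "(\<lambda>k. r ^ k) \<longlonglongrightarrow> 0"
    using ratio_props by (intro LIMSEQ_power_zero) auto
  have "(\<lambda>k. real k * r ^ k / (1 - 2 * q)) \<longlonglongrightarrow> 0 / (1 - 2 * q)"
    using ratio_props q by (intro tendsto_intros powser_times_n_limit_0) auto
  then show "(\<lambda>k. real k * r ^ k / (1 - 2 * q)) \<longlonglongrightarrow> 0"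
    by simp
qed

text \<open>Gambler's ruin: the bound by \<open>r ^ k\<close> squeezes the sums to 0 for large
  \<open>k\<close>, so their difference from \<open>r ^ k\<close> meets the uniqueness criterion and
  vanishes.\<close>

lemma lead_prob_sums: "lead_prob q k sums (r ^ k)"
proof -
  let ?s = "\<lambda>k. \<Sum>t. lead_prob q k t"
  have "?s \<longlonglongrightarrow> 0"
    by (rule tendsto_sandwich[OF _ _ tendsto_const ratio_power_tendsto(1)])
      (use q in \<open>auto intro!: always_eventually suminf_nonneg suminf_le_const
        lead_prob_summable lead_prob_nonneg sum_lead_prob_le\<close>)
  then have lim: "(\<lambda>k. ?s k - r ^ k) \<longlonglongrightarrow> 0"
    using tendsto_diff[OF _ ratio_power_tendsto(1)] by force
  have s0: "?s 0 = 1"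
    using sums_unique[OF sums_single[of 0 "\<lambda>_. 1::real"]] by (simp add: of_bool_def)
  have "?s k - r ^ k = 0"
  proof (rule ruin_recurrence_unique[OF q _ _ lim])
    fix k
    show "?s (Suc k) - r ^ Suc k =
        q * (?s k - r ^ k) + (1 - q) * (?s (Suc (Suc k)) - r ^ Suc (Suc k))"
      unfolding right_diff_distrib using suminf_lead_prob_Suc[of k] ratio_power[of k] by linarith
  qed (simp add: s0 del: lead_prob.simps)
  then show ?thesis
    using summable_sums[OF lead_prob_summable[of k]] by simp
qed

lemma time_lead_prob_sums: "(\<lambda>t. real t * lead_prob q k t) sums (real k * r ^ k / (1 - 2 * q))"
proof -
  let ?e = "\<lambda>k. \<Sum>t. real t * lead_prob q k t" and ?c = "\<lambda>k. real k * r ^ k / (1 - 2 * q)"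
  have "?e \<longlonglongrightarrow> 0"
    by (rule tendsto_sandwich[OF _ _ tendsto_const ratio_power_tendsto(2)])
      (use q in \<open>auto intro!: always_eventually suminf_nonneg suminf_le_const
        mult_nonneg_nonneg time_lead_prob_summable lead_prob_nonneg sum_time_lead_prob_le\<close>)
  then have lim: "(\<lambda>k. ?e k - ?c k) \<longlonglongrightarrow> 0"
    using tendsto_diff[OF _ ratio_power_tendsto(2)] by force
  have "?e k - ?c k = 0"
  proof (rule ruin_recurrence_unique[OF q _ _ lim])
    fix k
    \<comment> \<open>The forcing terms of the two recurrences cancel: the mass
      \<open>\<Sum>t. lead_prob q (Suc k) t\<close> equals \<open>r ^ Suc k\<close> by
      \<open>lead_prob_sums\<close>.\<close>
    show "?e (Suc k) - ?c (Suc k) =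
        q * (?e k - ?c k) + (1 - q) * (?e (Suc (Suc k)) - ?c (Suc (Suc k)))"
      unfolding right_diff_distrib
      using suminf_time_lead_prob_Suc[of k] time_ratio_power[of k] sums_unique[OF lead_prob_sums, of "Suc k"]
      by linarith
    have e0: "real t * lead_prob q 0 t = 0" for t
      by (cases t) simp_all
    show "?e 0 - ?c 0 = 0"
      unfolding e0 by simp
  qed
  then show ?thesis
    using summable_sums[OF time_lead_prob_summable[of k]] by simp
qed

text \<open>Each of the \<open>n - m\<close> factors \<open>r\<close> trades one
  \<open>1 - q\<close> for one \<open>q\<close>. This interchanges the exponents and explains the
  weights in \<open>A_n\<close> and in the last sum of \<open>R_n\<close>.\<close>

lemma ratio_weight: "m < n \<Longrightarrow> (1 - q) ^ n * q ^ m * r ^ (n - m) = q ^ n * (1 - q) ^ m"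
  using q by (simp add: r_def power_divide power_diff field_simps)

section \<open>The winning probability and the conditional expectation\<close>

lemma q_bounds: "0 \<le> q" "q \<le> 1" "q < 1"
  using q by auto

interpretation prob_space "goal_space q"
  by (rule prob_space_goal_space)

text \<open>The events for different \<open>t\<close> are disjoint, so the probability is the total
  first-passage mass times the Phase I weight.\<close>

lemma prob_catches_up_ever:
  assumes "m < n"
  shows "prob {\<omega>. \<exists>t. catches_up n m t \<omega>} = real ((n + m - 1) choose m) * (q ^ n * (1 - q) ^ m)"
proof -
  have union: "(\<lambda>t. prob {\<omega>. catches_up n m t \<omega>}) sums prob (\<Union>t. {\<omega>. catches_up n m t \<omega>})"
  proof (rule finite_measure_UNION)
    show "range (\<lambda>t. {\<omega>. catches_up n m t \<omega>}) \<subseteq> events"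
      using catches_up_measurable by (auto simp: pred_def)
  qed (auto simp: disjoint_family_on_def catches_up_def dest: first_lead_unique)
  have "(\<lambda>t. prob {\<omega>. catches_up n m t \<omega>}) sums
      (real ((n + m - 1) choose m) * (1 - q) ^ n * q ^ m * r ^ (n - m))"
    unfolding prob_catches_up[OF q_bounds(1,2)] by (intro sums_mult lead_prob_sums)
  from sums_unique2[OF union this] show ?thesis
    using ratio_weight[OF assms] by (simp add: mult.assoc Collect_ex_eq)
qed

lemma atLeastAtMost_pred_eq: "n \<ge> 1 \<Longrightarrow> {0..n - 1} = {..<n}" for n :: nat
  by auto

text \<open>Phase I ends almost surely, so \<open>?late\<close> complements \<open>?early\<close>
  and gives the first two terms of \<open>R_n\<close>; the comeback gives the third. Positivity,
  needed for conditioning, comes from the comeback alone.\<close>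

lemma prob_B_wins:
  assumes "n \<ge> 1"
  shows "prob {\<omega>. B_wins n \<omega>} = R_n n q" "R_n n q > 0"
proof -
  let ?late = "{\<omega>. phase1_terminates n \<omega> \<and> (\<forall>m<n. \<not> phase1_ends n m \<omega>)}"
  let ?early = "\<Union>m<n. {\<omega>. phase1_ends n m \<omega>}"
  let ?comeback = "\<Union>m<n. {\<omega>. \<exists>t. catches_up n m t \<omega>}"
  have late[measurable]: "?late \<in> events"
    by (rule sets_goal_space_Collect) measurable
  have ends[measurable]: "{\<omega>. phase1_ends n m \<omega>} \<in> events" for m
    by (rule sets_goal_space_Collect) measurable
  have comeback[measurable]: "{\<omega>. \<exists>t. catches_up n m t \<omega>} \<in> events" for m
    by (rule sets_goal_space_Collect) measurable
  have early_eq: "prob ?early = (\<Sum>m<n. prob {\<omega>. phase1_ends n m \<omega>})"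
    by (rule finite_measure_finite_Union)
      (auto simp: disjoint_family_on_def dest: phase1_ends_unique)
  have comeback_eq: "prob ?comeback = (\<Sum>m<n. prob {\<omega>. \<exists>t. catches_up n m t \<omega>})"
  proof (rule finite_measure_finite_Union)
    show "disjoint_family_on (\<lambda>m. {\<omega>. \<exists>t. catches_up n m t \<omega>}) {..<n}"
      by (auto simp: disjoint_family_on_def catches_up_def dest: phase1_ends_unique)
  qed auto
  have "prob (?late \<union> ?early) = prob ?late + prob ?early"
    by (rule finite_measure_Union) auto
  moreover have "?late \<union> ?early = {\<omega>. phase1_terminates n \<omega>}"
    by (auto simp: phase1_ends_iff)
  ultimately have late_eq: "prob ?late = 1 - prob ?early"
    using prob_phase1_terminates[OF q_bounds(1,3)] by simp
  have "prob (?late \<union> ?comeback) = prob ?late + prob ?comeback"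
  proof (rule finite_measure_Union)
    show "?late \<inter> ?comeback = {}"
      by (auto simp: catches_up_def)
  qed auto
  moreover have "{\<omega>. B_wins n \<omega>} = ?late \<union> ?comeback"
    by (auto simp: B_wins_iff)
  ultimately have eq: "prob {\<omega>. B_wins n \<omega>} = 1 - prob ?early + prob ?comeback"
    using late_eq by simp
  then show R: "prob {\<omega>. B_wins n \<omega>} = R_n n q"
    unfolding early_eq comeback_eq R_n_def atLeastAtMost_pred_eq[OF assms] sum_distrib_left
    by (simp add: prob_phase1_ends[OF q_bounds(1,2)] prob_catches_up_ever mult_ac)
  have "0 < prob ?comeback"
    unfolding comeback_eq using assms q
    by (intro sum_pos) (auto simp: prob_catches_up_ever lessThan_empty_iff)
  then show "R_n n q > 0"
    unfolding R[symmetric] eq using prob_le_1[of ?early] by linarith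
qed

lemma suminf_duration_catches_up:
  assumes "m < n"
  shows "(\<Sum>t. ennreal (real t * prob {\<omega>. catches_up n m t \<omega>})) =
    ennreal (q ^ n / (1 - 2 * q) * (real ((n + m - 1) choose m) * (1 - q) ^ m * (real n - real m)))"
proof -
  have "(\<lambda>t. real ((n + m - 1) choose m) * (1 - q) ^ n * q ^ m * (real t * lead_prob q (n - m) t)) sums
    (real ((n + m - 1) choose m) * (1 - q) ^ n * q ^ m * (real (n - m) * r ^ (n - m) / (1 - 2 * q)))"
    by (intro sums_mult time_lead_prob_sums)
  also have "real ((n + m - 1) choose m) * (1 - q) ^ n * q ^ m * (real (n - m) * r ^ (n - m) / (1 - 2 * q)) =
    real ((n + m - 1) choose m) * real (n - m) / (1 - 2 * q) * ((1 - q) ^ n * q ^ m * r ^ (n - m))"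
    by simp
  also have "\<dots> = q ^ n / (1 - 2 * q) * (real ((n + m - 1) choose m) * (1 - q) ^ m * (real n - real m))"
    unfolding ratio_weight[OF assms] using assms by (simp add: of_nat_diff)
  finally have "(\<lambda>t. real t * prob {\<omega>. catches_up n m t \<omega>}) sums \<dots>"
    by (simp add: prob_catches_up[OF q_bounds(1,2)] mult_ac)
  then show ?thesis
    by (subst suminf_ennreal2) (auto simp: sums_iff)
qed

text \<open>All terms are nonnegative, so integral, series and finite sum may be interchanged
  freely; finiteness of the result comes out of the computation.\<close>

lemma nn_integral_duration:
  assumes "n \<ge> 1"
  shows "(\<integral>\<^sup>+\<omega>. (\<Sum>t. \<Sum>m<n. of_nat t * indicator {\<omega>. catches_up n m t \<omega>} \<omega>) \<partial>goal_space q) =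
    ennreal (A_n n q)"
proof -
  have [measurable]: "{\<omega>. catches_up n m t \<omega>} \<in> events" for m t
    by (rule sets_goal_space_Collect) measurable
  have "(\<integral>\<^sup>+\<omega>. (\<Sum>m<n. of_nat t * indicator {\<omega>. catches_up n m t \<omega>} \<omega>) \<partial>goal_space q) =
      (\<Sum>m<n. \<integral>\<^sup>+\<omega>. of_nat t * indicator {\<omega>. catches_up n m t \<omega>} \<omega> \<partial>goal_space q)" for t
    by (rule nn_integral_sum) measurable
  also have "\<dots> t = (\<Sum>m<n. ennreal (real t * prob {\<omega>. catches_up n m t \<omega>}))" for t
    by (simp add: nn_integral_cmult emeasure_eq_measure ennreal_mult ennreal_of_nat_eq_real_of_nat)
  finally have "(\<integral>\<^sup>+\<omega>. (\<Sum>t. \<Sum>m<n. of_nat t * indicator {\<omega>. catches_up n m t \<omega>} \<omega>) \<partial>goal_space q) =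
      (\<Sum>t. \<Sum>m<n. ennreal (real t * prob {\<omega>. catches_up n m t \<omega>}))"
    by (subst nn_integral_suminf) measurable
  also have "\<dots> = (\<Sum>m<n. \<Sum>t. ennreal (real t * prob {\<omega>. catches_up n m t \<omega>}))"
    by (rule suminf_sum) simp
  also have "\<dots> = (\<Sum>m<n. ennreal
      (q ^ n / (1 - 2 * q) * (real ((n + m - 1) choose m) * (1 - q) ^ m * (real n - real m))))"
    by (intro sum.cong refl suminf_duration_catches_up) auto
  also have "\<dots> = ennreal (A_n n q)"
    unfolding A_n_def atLeastAtMost_pred_eq[OF assms] sum_distrib_left
    using q by (intro sum_ennreal mult_nonneg_nonneg) auto
  finally show ?thesis .
qed

lemma expected_duration_eq:
  assumes "n \<ge> 1"
  shows "expected_duration n q = ennreal (A_n n q / R_n n q)"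
proof -
  let ?W = "{\<omega>. B_wins n \<omega>}"
  let ?f = "\<lambda>\<omega>. \<Sum>t. \<Sum>m<n. of_nat t * indicator {\<omega>. catches_up n m t \<omega>} \<omega> :: ennreal"
  have W[measurable]: "?W \<in> events"
    by (rule sets_goal_space_Collect) measurable
  have [measurable]: "{\<omega>. catches_up n m t \<omega>} \<in> events" for m t
    by (rule sets_goal_space_Collect) measurable
  \<comment> \<open>The conditional measure is concentrated on \<open>?W\<close>, where the duration
    agrees with the series; elsewhere the two may differ.\<close>
  have "expected_duration n q = (\<integral>\<^sup>+\<omega>. ?f \<omega> \<partial>uniform_measure (goal_space q) ?W)"
    unfolding expected_duration_def space_goal_space
    by (simp, intro nn_integral_cong_AE AE_uniform_measureI W AE_I2)
      (simp add: phase2_duration_eq_sum)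
  also have "\<dots> = (\<integral>\<^sup>+\<omega>. ?f \<omega> * indicator ?W \<omega> \<partial>goal_space q) / emeasure (goal_space q) ?W"
    by (rule nn_integral_uniform_measure) measurable
  also have "(\<integral>\<^sup>+\<omega>. ?f \<omega> * indicator ?W \<omega> \<partial>goal_space q) = (\<integral>\<^sup>+\<omega>. ?f \<omega> \<partial>goal_space q)"
  proof (intro nn_integral_cong)
    fix \<omega>
    show "?f \<omega> * indicator ?W \<omega> = ?f \<omega>"
    proof (cases "B_wins n \<omega>")
      case False
      then have "\<not> catches_up n m t \<omega>" if "m < n" for m t
        using that by (auto simp: B_wins_iff)
      then have "?f \<omega> = 0"
        by (simp add: indicator_def)
      then show ?thesis by simp
    qed simp
  qed
  also have "\<dots> / emeasure (goal_space q) ?W = ennreal (A_n n q) / ennreal (R_n n q)"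
    by (simp only: nn_integral_duration[OF assms] emeasure_eq_measure prob_B_wins(1)[OF assms])
  also have "\<dots> = ennreal (A_n n q / R_n n q)"
  proof (rule divide_ennreal)
    show "0 \<le> A_n n q"
      unfolding A_n_def atLeastAtMost_pred_eq[OF assms]
      using q by (intro mult_nonneg_nonneg sum_nonneg) auto
  qed (rule prob_B_wins[OF assms])
  finally show ?thesis .
qed

end

theorem theorem3:
  fixes q :: real and n :: nat
  assumes "0 < q" and "q < 1 / 2" and "n \<ge> 1"
  shows "expected_duration n q = ennreal (A_n n q / R_n n q)"
  using assms by (rule expected_duration_eq)

end
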